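(* Let $(V,\omega)$ be a simple VOA of strong CFT type over $\mathbb{K}$. Then $CV_{sCFT}\cap V_2=\{\omega\}$.
   Context: The base field $\mathbb{K}$ is $\mathbb{R}$ or $\mathbb{C}$. For a vertex algebra $V$ over $\mathbb{K}$ with vacuum vector $\mathbf{1}$, $a(n)b$ denotes the $n$-th product ($n\in\mathbb{Z}$), $a(n)\in\mathrm{End}\,V$, and $Ta=a(-2)\mathbf{1}$. A $\mathbb{Z}$-graded vertex algebra is a vertex algebra $V=\bigoplus_{n\in\mathbb{Z}}V_n$ with $V_n(k)V_m\subset V_{n+m-k-1}$ and $\mathbf{1}\in V_0$. A $\mathbb{Z}$-graded conformal vertex algebra $(V,\omega)$ is a $\mathbb{Z}$-graded vertex algebra with a distinguished $\omega\in V_2$ such that the operators $L(n)=\omega(n+1)$ satisfy $[L(n),L(m)]=(n-m)L(n+m)+\frac{1}{12}\delta_{n+m,0}(n^3-n)c$ for some $c\in\mathbb{K}$, $L(0)v=nv$ for $v\in V_n$, and $L(-1)=T$. It is a VOA of CFT type if $V=\bigoplus_{n\in\mathbb{N}}V_n$ (with $\mathbb{N}=\{0,1,2,\dots\}$), $\dim V_n<\infty$ for all $n$, and $V_0=\mathbb{K}\mathbf{1}$. It is a VOA of strong CFT type if moreover $L(1)V_1=0$. Simple means that $V$ has no nontrivial proper ideals. $CV_{sCFT}$ is the set of conformal vectors of strong CFT type of $V$, i.e. of $a\in V$ such that $(V,a)$, with grading $V=\bigoplus_n V_n^a$, $V_n^a=\{v\in V\mid a(1)v=nv\}$, is a VOA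 of strong CFT type. $V_2$ is the degree-2 space for the grading given by $\omega$. *)

theory Defs
  imports Complex_Main "HOL-Library.Groups_Big_Fun"
begin

text \<open>
  The whole type \<open>'v\<close> is the underlying vector space, and \<open>nprod a n b\<close> is
  the \<open>n\<close>-th product \<open>a(n)b\<close>. The last axiom is the Borcherds identity
  applied to a vector \<open>c\<close>; because of truncation each of its three sums has only finitely
  many nonzero terms, so that \<open>Sum_any\<close> is the honest sum.
\<close>

locale vertex_algebra = vector_space scale
  for scale :: "'k::field_char_0 \<Rightarrow> 'v::ab_group_add \<Rightarrow> 'v" +
  fixes nprod :: "'v \<Rightarrow> int \<Rightarrow> 'v \<Rightarrow> 'v"
    and vac :: 'v
  assumes linear_left: "Vector_Spaces.linear scale scale (\<lambda>a. nprod a n b)"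
    and linear_right: "Vector_Spaces.linear scale scale (nprod a n)"
    and truncation: "\<exists>N. \<forall>n\<ge>N. nprod a n b = 0"
    and vac_left: "nprod vac n a = (if n = - 1 then a else 0)"
    and vac_right: "n \<ge> 0 \<Longrightarrow> nprod a n vac = 0"
    and creation: "nprod a (- 1) vac = a"
    and borcherds:
      "Sum_any (\<lambda>i::nat. scale (of_int p gchoose i)
          (nprod (nprod a (r + int i) b) (p + q - int i) c)) =
       Sum_any (\<lambda>i::nat. scale ((- 1) ^ i * (of_int r gchoose i))
          (nprod a (r + p - int i) (nprod b (q + int i) c))) -
       Sum_any (\<lambda>i::nat. scale ((- 1) powi r * (- 1) ^ i * (of_int r gchoose i))
          (nprod b (r + q - int i) (nprod a (p + int i) c)))"
begin

definition translation :: "'v \<Rightarrow> 'v" where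
  "translation a = nprod a (- 2) vac"

definition ideal :: "'v set \<Rightarrow> bool" where
  "ideal I \<longleftrightarrow> subspace I \<and>
     (\<forall>a. \<forall>v\<in>I. \<forall>n. nprod a n v \<in> I \<and> nprod v n a \<in> I)"

definition is_simple :: bool where
  "is_simple \<longleftrightarrow> (\<forall>I. ideal I \<longrightarrow> I = {0} \<or> I = UNIV)"

end

locale graded_vertex_algebra = vertex_algebra scale nprod vac
  for scale :: "'k::field_char_0 \<Rightarrow> 'v::ab_group_add \<Rightarrow> 'v"
    and nprod :: "'v \<Rightarrow> int \<Rightarrow> 'v \<Rightarrow> 'v"
    and vac :: 'v +
  fixes V :: "int \<Rightarrow> 'v set"
  assumes subspace_V: "subspace (V n)"
    and direct_sum: "\<exists>!f. (\<forall>n. f n \<in> V n) \<and> finite {n. f n \<noteq> 0} \<and> v = Sum_any f"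
    and nprod_grading:
      "\<lbrakk>a \<in> V n; b \<in> V m\<rbrakk> \<Longrightarrow> nprod a k b \<in> V (n + m - k - 1)"
    and vac_grading: "vac \<in> V 0"

text \<open>Below, \<open>nprod \<omega> (n + 1)\<close> is the Virasoro operator \<open>L(n)\<close>.\<close>

locale conformal_vertex_algebra = graded_vertex_algebra scale nprod vac V
  for scale :: "'k::field_char_0 \<Rightarrow> 'v::ab_group_add \<Rightarrow> 'v"
    and nprod :: "'v \<Rightarrow> int \<Rightarrow> 'v \<Rightarrow> 'v"
    and vac :: 'v
    and V :: "int \<Rightarrow> 'v set" +
  fixes \<omega> :: 'v
  assumes omega_grading: "\<omega> \<in> V 2"
    and virasoro:
      "\<exists>c. \<forall>n m v.
         nprod \<omega> (n + 1) (nprod \<omega> (m + 1) v) - nprod \<omega> (m + 1) (nprod \<omega> (n + 1) v) =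
         scale (of_int (n - m)) (nprod \<omega> (n + m + 1) v) +
         scale (1 / 12 * (if n + m = 0 then 1 else 0) * of_int (n ^ 3 - n) * c) v"
    and L0_grading: "v \<in> V n \<Longrightarrow> nprod \<omega> (0 + 1) v = scale (of_int n) v"
    and L_minus_1: "nprod \<omega> (- 1 + 1) v = translation v"

locale cft_type_voa = conformal_vertex_algebra scale nprod vac V \<omega>
  for scale :: "'k::field_char_0 \<Rightarrow> 'v::ab_group_add \<Rightarrow> 'v"
    and nprod :: "'v \<Rightarrow> int \<Rightarrow> 'v \<Rightarrow> 'v"
    and vac :: 'v
    and V :: "int \<Rightarrow> 'v set"
    and \<omega> :: 'v +
  assumes nonneg_grading: "n < 0 \<Longrightarrow> V n = {0}"
    and finite_dim: "\<exists>B. finite B \<and> span B = V n"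
    and V0: "V 0 = span {vac}"

locale strong_cft_type_voa = cft_type_voa scale nprod vac V \<omega>
  for scale :: "'k::field_char_0 \<Rightarrow> 'v::ab_group_add \<Rightarrow> 'v"
    and nprod :: "'v \<Rightarrow> int \<Rightarrow> 'v \<Rightarrow> 'v"
    and vac :: 'v
    and V :: "int \<Rightarrow> 'v set"
    and \<omega> :: 'v +
  assumes L1_V1: "v \<in> V 1 \<Longrightarrow> nprod \<omega> (1 + 1) v = 0"

locale simple_strong_cft_type_voa = strong_cft_type_voa scale nprod vac V \<omega>
  for scale :: "'k::field_char_0 \<Rightarrow> 'v::ab_group_add \<Rightarrow> 'v"
    and nprod :: "'v \<Rightarrow> int \<Rightarrow> 'v \<Rightarrow> 'v"
    and vac :: 'v
    and V :: "int \<Rightarrow> 'v set"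
    and \<omega> :: 'v +
  assumes simple: is_simple

definition CV_sCFT ::
  "('k::field_char_0 \<Rightarrow> 'v::ab_group_add \<Rightarrow> 'v) \<Rightarrow> ('v \<Rightarrow> int \<Rightarrow> 'v \<Rightarrow> 'v) \<Rightarrow> 'v \<Rightarrow> 'v set"
  where
  "CV_sCFT scale nprod vac =
     {a. strong_cft_type_voa scale nprod vac
           (\<lambda>n. {v. nprod a 1 v = scale (of_int n) v}) a}"

end

theory Submission imports Defs begin

text \<open>
  Let \<open>a\<close> be a conformal vector of strong CFT type in \<open>V 2\<close>, and write \<open>V' n\<close> for its degree-\<open>n\<close>
  space. Put \<open>v = \<omega> - a\<close>. Both vectors have zero mode \<open>T\<close>, so \<open>v(0) = 0\<close>; the commutators
  \<open>[\<omega>(m), v(0)] = 0\<close> then force \<open>v\<close> to behave like \<open>T w\<close> with \<open>w = L(1)v / 2 \<in> V 1\<close>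
  (lemma \<open>modes_if_zero_mode_eq_0\<close>). The goal is \<open>w = 0\<close>: then \<open>T v = 0\<close> and \<open>L(1)v = 0\<close>, and
  \<open>[L(1), L(-1)] = 2 L(0)\<close> applied to \<open>v\<close> gives \<open>4 v = 0\<close>.

  Simplicity enters through the nondegeneracy of the pairing \<open>u(1)v\<close> on \<open>V 1\<close>
  (lemma \<open>nondegenerate_V1\<close>), which is proved directly from the ideal generated by an element
  of the radical, without an invariant bilinear form on all of \<open>V\<close>.

  Nondegeneracy is used twice. The operators \<open>\<omega>(1)\<close> and \<open>a(1)\<close> commute, so \<open>V 1\<close> is the sum of
  its intersections with the \<open>V' n\<close>, and only \<open>n \<ge> 1\<close> contributes because
  \<open>V' 0 = V 0\<close> is the span of the vacuum vector. For \<open>x \<in> V 1 \<inter> V' n\<close> and \<open>y \<in> V 1 \<inter> V' m\<close>, the vector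
  \<open>x(1)y\<close> lies in \<open>V 0 = V' 0\<close> and in \<open>V' (n + m - 2)\<close>. It is therefore zero if \<open>n \<ge> 2\<close>,
  so that \<open>x = 0\<close>; hence \<open>V 1 \<subseteq> V' 1\<close> (lemma \<open>V1_subset\<close>). Now both \<open>\<omega>(2)\<close> and \<open>a(2)\<close> vanish on \<open>V 1\<close>,
  so \<open>v(2) = -2 w(1)\<close> does too, and nondegeneracy yields \<open>w = 0\<close>.
\<close>

section \<open>Sums with finite support\<close>

lemma Sum_any_eq_sum:
  assumes "finite A" and "\<And>i. i \<notin> A \<Longrightarrow> f i = 0"
  shows "Sum_any f = sum f A"
  using assms by (intro Sum_any.expand_superset) auto

lemma Sum_any_eq_single:
  assumes "\<And>i. i \<noteq> k \<Longrightarrow> f i = 0"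
  shows "Sum_any f = f k"
  using Sum_any_eq_sum[of "{k}" f] assms by auto

lemma (in vector_space) subspace_Sum_any:
  assumes "subspace S" and "\<And>i. f i \<in> S"
  shows "Sum_any f \<in> S"
  unfolding Sum_any.expand_set using assms by (intro subspace_sum) auto

section \<open>Consequences of the Borcherds identity\<close>

context vertex_algebra
begin

lemma module_hom_left: "module_hom scale scale (\<lambda>a. nprod a n b)"
  using linear_left by (simp add: Vector_Spaces.linear_iff_module_hom)

lemma module_hom_right: "module_hom scale scale (nprod a n)"
  using linear_right by (simp add: Vector_Spaces.linear_iff_module_hom)

lemmas nprod_add_right = module_hom.add[OF module_hom_right]
  and nprod_scale_left = module_hom.scale[OF module_hom_left]
  and nprod_scale_right = module_hom.scale[OF module_hom_right]
  and nprod_diff_left = module_hom.diff[OF module_hom_left]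
  and nprod_diff_right = module_hom.diff[OF module_hom_right]
  and nprod_zero_left [simp] = module_hom.zero[OF module_hom_left]
  and nprod_zero_right [simp] = module_hom.zero[OF module_hom_right]
  and nprod_sum_left = module_hom.sum[OF module_hom_left]
  and nprod_sum_right = module_hom.sum[OF module_hom_right]

lemma commutator:
  "Sum_any (\<lambda>i::nat. scale (of_int p gchoose i) (nprod (nprod a (int i) b) (p + q - int i) c)) =
   nprod a p (nprod b q c) - nprod b q (nprod a p c)"
proof -
  have 1: "Sum_any (\<lambda>i::nat. scale ((- 1) ^ i * (of_int 0 gchoose i))
          (nprod a (0 + p - int i) (nprod b (q + int i) c))) = nprod a p (nprod b q c)"
    by (subst Sum_any_eq_single[of 0]) (auto simp: gbinomial_0_left)
  have 2: "Sum_any (\<lambda>i::nat. scale ((- 1) powi 0 * (- 1) ^ i * (of_int 0 gchoose i))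
          (nprod b (0 + q - int i) (nprod a (p + int i) c))) = nprod b q (nprod a p c)"
    by (subst Sum_any_eq_single[of 0]) (auto simp: gbinomial_0_left)
  show ?thesis
    using borcherds[of p a 0 b q c] unfolding 1 2 by simp
qed

lemma commutator_truncated:
  assumes "\<And>i. i \<ge> k \<Longrightarrow> nprod a (int i) b = 0"
  shows "nprod a p (nprod b q c) - nprod b q (nprod a p c) =
    (\<Sum>i<k. scale (of_int p gchoose i) (nprod (nprod a (int i) b) (p + q - int i) c))"
  unfolding commutator[symmetric] using assms by (intro Sum_any_eq_sum) auto

lemma nprod_translation: "nprod (translation a) n c = scale (of_int (- n)) (nprod a (n - 1) c)"
proof -
  \<comment> \<open>The left-hand side of the Borcherds identity for \<open>b = \<one>\<close>, \<open>p = n\<close>, \<open>q = 0\<close>, \<open>r = -2\<close>;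
    all terms on the right-hand side vanish.\<close>
  let ?f = "\<lambda>i::nat. scale (of_int n gchoose i)
    (nprod (nprod a (- 2 + int i) vac) (n + 0 - int i) c)"
  have 1: "Sum_any ?f = nprod (translation a) n c + scale (of_int n) (nprod a (n - 1) c)"
  proof -
    have "Sum_any ?f = sum ?f {..<2}"
      by (intro Sum_any_eq_sum) (auto simp: vac_right)
    then show ?thesis
      by (simp add: numeral_2_eq_2 translation_def creation)
  qed
  have "Sum_any ?f = 0"
    unfolding borcherds by (simp add: vac_left vac_right)
  with 1 show ?thesis
    by (simp add: add_eq_0_iff2)
qed

text \<open>Skew-symmetry, with \<open>T^i x / i!\<close> written as \<open>x(-1-i)\<one>\<close>.\<close>

lemma skew_symmetry:
  "Sum_any (\<lambda>i::nat. scale ((- 1) ^ i) (nprod (nprod a (n + int i) b) (- 1 - int i) vac)) =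
   scale (- ((- 1) powi n)) (nprod b n a)"
proof -
  have 1: "Sum_any (\<lambda>i::nat. scale ((- 1) ^ i * (of_int n gchoose i))
          (nprod a (n + (- 1) - int i) (nprod b (0 + int i) vac))) = 0"
    by (simp add: vac_right)
  have 2: "Sum_any (\<lambda>i::nat. scale ((- 1) powi n * (- 1) ^ i * (of_int n gchoose i))
          (nprod b (n + 0 - int i) (nprod a (- 1 + int i) vac))) =
          scale ((- 1) powi n) (nprod b n a)"
    by (subst Sum_any_eq_single[of 0]) (auto simp: creation vac_right)
  have 3: "((- 1 :: 'k) gchoose i) = (- 1) ^ i" for i
    using gbinomial_minus[of "1 :: 'k" i] binomial_gbinomial[of i i, where ?'a = 'k] by simp
  show ?thesis
    using borcherds[of "- 1" a n b 0 vac] unfolding 1 2 by (simp add: 3)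
qed

text \<open>Applied to the span of all \<open>x(k)c\<close>, this shows that the span is stable under every \<open>a(m)\<close>.
  Choosing \<open>p\<close> so large that \<open>a(p+i)c = 0\<close> for all \<open>i \<ge> 0\<close> turns the Borcherds identity into a
  recursion for \<open>a(m)b(q)c\<close>, downward in \<open>q\<close>.\<close>

lemma nprod_nprod_in_subspace:
  assumes S: "subspace S" and c: "\<And>x k. nprod x k c \<in> S"
  shows "nprod a m (nprod b q c) \<in> S"
proof -
  obtain P where P: "\<And>n. n \<ge> P \<Longrightarrow> nprod a n c = 0"
    using truncation by blast
  obtain N where N: "\<And>n. n \<ge> N \<Longrightarrow> nprod b n c = 0"
    using truncation by blast
  have "\<forall>m q. q \<ge> N - int j \<longrightarrow> nprod a m (nprod b q c) \<in> S" for j :: nat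
  proof (induction j)
    case 0
    show ?case using S by (auto simp: N subspace_0)
  next
    case (Suc j)
    show ?case
    proof (intro allI impI)
      fix m q assume q: "q \<ge> N - int (Suc j)"
      let ?g = "\<lambda>i::nat. scale ((- 1) ^ i * (of_int (m - P) gchoose i))
          (nprod a (m - P + P - int i) (nprod b (q + int i) c))"
      have g: "Sum_any ?g = ?g 0 + (\<Sum>i<j. ?g (Suc i))"
      proof -
        have "Sum_any ?g = sum ?g {..<Suc j}"
          using q by (intro Sum_any_eq_sum) (auto simp: N)
        then show ?thesis by (simp only: sum.lessThan_Suc_shift)
      qed
      have "Sum_any ?g \<in> S"
      proof -
        have "Sum_any (\<lambda>i::nat. scale ((- 1) powi (m - P) * (- 1) ^ i * (of_int (m - P) gchoose i))
          (nprod b (m - P + q - int i) (nprod a (P + int i) c))) = 0"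
          by (simp add: P)
        then have "Sum_any ?g = Sum_any (\<lambda>i::nat. scale (of_int P gchoose i)
          (nprod (nprod a (m - P + int i) b) (P + q - int i) c))"
          using borcherds[of P a "m - P" b q c] by simp
        then show ?thesis
          using S c by (auto intro!: subspace_Sum_any subspace_scale)
      qed
      moreover have "(\<Sum>i<j. ?g (Suc i)) \<in> S"
        using S q Suc.IH by (intro subspace_sum subspace_scale) auto
      ultimately have "Sum_any ?g - (\<Sum>i<j. ?g (Suc i)) \<in> S"
        by (rule subspace_diff[OF S])
      then have "?g 0 \<in> S"
        unfolding g by (simp only: add_diff_cancel_right')
      then show "nprod a m (nprod b q c) \<in> S" by simp
    qed
  qed
  from this[of "nat (N - q)"] show ?thesis by auto
qed

text \<open>Skew-symmetry makes a left ideal two-sided, once it is stable under \<open>T\<close>.\<close>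

lemma ideal_if_left_ideal:
  assumes S: "subspace S" and left: "\<And>a n v. v \<in> S \<Longrightarrow> nprod a n v \<in> S"
    and T: "\<And>v. v \<in> S \<Longrightarrow> translation v \<in> S"
  shows "ideal S"
proof -
  have vac: "nprod x (- 1 - int i) vac \<in> S" if "x \<in> S" for x i
    using that
  proof (induction i arbitrary: x)
    case 0
    then show ?case by (simp add: creation)
  next
    case (Suc i)
    have "scale (of_int (1 + int i)) (nprod x (- 1 - int (Suc i)) vac) =
      nprod (translation x) (- 1 - int i) vac"
      by (simp add: nprod_translation algebra_simps)
    also have "\<dots> \<in> S" using Suc T by blast
    finally have "scale (inverse (of_int (1 + int i)))
       (scale (of_int (1 + int i)) (nprod x (- 1 - int (Suc i)) vac)) \<in> S"
      using S subspace_scale by blast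
    moreover have "(of_int (1 + int i) :: 'k) \<noteq> 0"
      by (simp only: of_int_eq_0_iff)
    ultimately show ?case by simp
  qed
  have "nprod v n a \<in> S" if v: "v \<in> S" for v n a
  proof -
    have "scale (- ((- 1) powi n)) (nprod v n a) \<in> S"
      unfolding skew_symmetry[symmetric]
      using S v by (intro subspace_Sum_any subspace_scale vac left)
    then have "scale (- ((- 1) powi n)) (scale (- ((- 1) powi n)) (nprod v n a)) \<in> S"
      using S subspace_scale by blast
    then show ?thesis
      by (simp flip: power_int_mult_distrib)
  qed
  with S left show ?thesis unfolding ideal_def by blast
qed

end

section \<open>Homogeneous components\<close>

context graded_vertex_algebra
begin

text \<open>The component of \<open>v\<close> in \<open>V n\<close>.\<close>

definition component :: "'v \<Rightarrow> int \<Rightarrow> 'v" where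
  "component v = (THE f. (\<forall>n. f n \<in> V n) \<and> finite {n. f n \<noteq> 0} \<and> v = Sum_any f)"

lemma component:
  "component v n \<in> V n" "finite {n. component v n \<noteq> 0}" "v = Sum_any (component v)"
  using theI'[OF direct_sum[of v]] unfolding component_def by auto

lemma component_unique:
  assumes "\<And>n. f n \<in> V n" "finite {n. f n \<noteq> 0}" "v = Sum_any f"
  shows "component v = f"
  using direct_sum[of v] assms component[of v] by metis

lemma sum_component: "v = (\<Sum>n\<in>{n. component v n \<noteq> 0}. component v n)"
  using component(3)[of v] unfolding Sum_any.expand_set .

lemma component_homogeneous:
  assumes "v \<in> V m"
  shows "component v n = (if n = m then v else 0)"
proof -
  have "component v = (\<lambda>n. if n = m then v else 0)"
    using assms subspace_0[OF subspace_V]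
    by (intro component_unique) (auto simp: Sum_any_eq_single[of m])
  then show ?thesis by simp
qed

lemma component_add: "component (u + v) n = component u n + component v n"
proof -
  have "component (u + v) = (\<lambda>n. component u n + component v n)"
  proof (rule component_unique)
    show "component u n + component v n \<in> V n" for n
      by (simp add: component(1) subspace_V subspace_add)
    show "finite {n. component u n + component v n \<noteq> 0}"
      by (rule finite_subset[OF _ finite_UnI[OF component(2)[of u] component(2)[of v]]]) auto
    show "u + v = Sum_any (\<lambda>n. component u n + component v n)"
      using component[of u] component[of v] by (simp add: Sum_any.distrib)
  qed
  then show ?thesis by simp
qed

lemma component_commute:
  assumes D: "module_hom scale scale D" and V: "\<And>n x. x \<in> V n \<Longrightarrow> D x \<in> V n"
  shows "component (D v) n = D (component v n)"
proof -
  interpret D: module_hom scale scale D by fact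
  have "component (D v) = (\<lambda>n. D (component v n))"
  proof (rule component_unique)
    show "D (component v n) \<in> V n" for n
      by (simp add: component(1) V)
    show "finite {n. D (component v n) \<noteq> 0}"
      by (rule finite_subset[OF _ component(2)[of v]]) auto
    have "Sum_any (\<lambda>n. D (component v n)) = (\<Sum>n\<in>{n. component v n \<noteq> 0}. D (component v n))"
      using component(2) by (intro Sum_any_eq_sum) auto
    also have "\<dots> = D v"
      by (subst (2) sum_component) (simp only: D.sum)
    finally show "D v = Sum_any (\<lambda>n. D (component v n))" by simp
  qed
  then show ?thesis by simp
qed

lemma component_scale: "component (scale r v) n = scale r (component v n)"
proof (rule component_commute)
  show "module_hom scale scale (scale r)"
    by unfold_locales (auto simp: scale_right_distrib mult.commute)
qed (simp add: subspace_V subspace_scale)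

lemma component_zero [simp]: "component 0 n = 0"
  using component_homogeneous[OF subspace_0[OF subspace_V]] by simp

lemma subspace_component_0: "subspace {v. component v n = 0}"
  by (auto simp: subspace_def component_add component_scale)

end

section \<open>Nondegeneracy of the pairing in degree one\<close>

context conformal_vertex_algebra
begin

text \<open>The spaces \<open>V n\<close> are the full eigenspaces of \<open>L(0)\<close>, so \<open>\<omega>\<close> determines the grading.\<close>

lemma mem_V_iff: "v \<in> V n \<longleftrightarrow> nprod \<omega> 1 v = scale (of_int n) v"
proof
  show "v \<in> V n \<Longrightarrow> nprod \<omega> 1 v = scale (of_int n) v"
    using L0_grading[of v n] by simp
next
  assume eig: "nprod \<omega> 1 v = scale (of_int n) v"
  have 0: "component v m = 0" if "m \<noteq> n" for m
  proof -
    have "scale (of_int n) (component v m) = component (nprod \<omega> 1 v) m"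
      by (simp add: eig component_scale)
    also have "\<dots> = nprod \<omega> 1 (component v m)"
      by (rule component_commute[OF module_hom_right]) (use L0_grading subspace_V subspace_scale in auto)
    also have "\<dots> = scale (of_int m) (component v m)"
      using L0_grading[OF component(1)[of v m]] by simp
    finally show ?thesis using that by simp
  qed
  have "v = component v n"
    using component(3)[of v] Sum_any_eq_single[of n "component v"] 0 by metis
  then show "v \<in> V n" using component(1)[of v n] by simp
qed

lemma omega_0: "nprod \<omega> 0 v = translation v"
  using L_minus_1[of v] by simp

lemma ideal_generated: "ideal (span {nprod x k c | x k. True})" (is "ideal ?S")
proof (rule ideal_if_left_ideal)
  show S: "subspace ?S" by simp
  have S': "subspace {v. nprod a n v \<in> ?S}" for a n
    using S by (auto simp: subspace_def nprod_add_right nprod_scale_right)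
  show left: "nprod a n v \<in> ?S" if "v \<in> ?S" for a n v
  proof -
    have "{nprod x k c | x k. True} \<subseteq> {v. nprod a n v \<in> ?S}"
    proof clarify
      fix x k
      show "nprod a n (nprod x k c) \<in> ?S"
        by (rule nprod_nprod_in_subspace[OF S]) (rule span_base, blast)
    qed
    then have "?S \<subseteq> {v. nprod a n v \<in> ?S}" by (rule span_minimal[OF _ S'])
    with that show ?thesis by auto
  qed
  show "translation v \<in> ?S" if "v \<in> ?S" for v
    using left[OF that] by (simp flip: omega_0)
qed

end

context strong_cft_type_voa
begin

lemma nprod_eq_0:
  assumes "a \<in> V n" "b \<in> V m" "k \<ge> n + m"
  shows "nprod a k b = 0"
  using nprod_grading[OF assms(1,2), of k] nonneg_grading[of "n + m - k - 1"] assms(3) by auto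

lemma L1_commutator:
  assumes w: "w \<in> V 1"
  shows "nprod \<omega> 2 (nprod w n c) - nprod w n (nprod \<omega> 2 c) =
    scale (of_int (- n)) (nprod w (n + 1) c)"
proof -
  have "nprod \<omega> 2 (nprod w n c) - nprod w n (nprod \<omega> 2 c) =
    (\<Sum>i<3. scale (of_int 2 gchoose i) (nprod (nprod \<omega> (int i) w) (2 + n - int i) c))"
    by (rule commutator_truncated) (rule nprod_eq_0[OF omega_grading w], simp)
  also have "\<dots> = nprod (translation w) (n + 2) c + scale 2 (nprod w (n + 1) c)"
    using L1_V1[OF w] L0_grading[OF w]
    by (simp add: numeral_3_eq_3 omega_0 add.commute)
  also have "\<dots> = scale (of_int (- n)) (nprod w (n + 1) c)"
    by (simp add: nprod_translation algebra_simps)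
  finally show ?thesis .
qed

lemma omega_1_commutes:
  assumes a: "a \<in> V 2"
  shows "nprod \<omega> 1 (nprod a 1 c) = nprod a 1 (nprod \<omega> 1 c)"
proof -
  have "nprod \<omega> 1 (nprod a 1 c) - nprod a 1 (nprod \<omega> 1 c) =
    (\<Sum>i<4. scale (of_int 1 gchoose i) (nprod (nprod \<omega> (int i) a) (1 + 1 - int i) c))"
    by (rule commutator_truncated) (rule nprod_eq_0[OF omega_grading a], simp)
  also have "\<dots> = 0"
    using L0_grading[OF a]
    by (simp add: eval_nat_numeral omega_0 nprod_translation nprod_scale_left gbinomial_Suc)
  finally show ?thesis by simp
qed

text \<open>Since \<open>v(0)\<close> is zero, it commutes with \<open>\<omega>(m)\<close>; expanding this commutator gives
  \<open>m v(m-1) = -m(m-1) w(m-2)\<close> for \<open>w = L(1)v / 2\<close>. These are the relations between the modes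
  of \<open>v\<close> and \<open>w\<close> in the case \<open>v = T w\<close>, except that \<open>m = 0\<close> carries no information.\<close>

lemma modes_if_zero_mode_eq_0:
  assumes v: "v \<in> V 2" and v0: "\<And>c. nprod v 0 c = 0"
  shows "scale (of_int m) (nprod v (m - 1) c) =
    scale (- (of_int m gchoose 2)) (nprod (nprod \<omega> 2 v) (m - 2) c)"
proof -
  have "nprod \<omega> 3 v \<in> span {vac}"
    using nprod_grading[OF omega_grading v, of 3] V0 by simp
  then obtain k where k: "nprod \<omega> 3 v = scale k vac"
    by (auto simp: span_singleton)
  \<comment> \<open>The vacuum term occurs only for \<open>m = 2\<close>, where its coefficient vanishes.\<close>
  have vac: "scale (of_int m gchoose 3) (nprod (scale k vac) (m - 3) c) = 0"
    by (cases "m = 2") (simp_all add: nprod_scale_left vac_left eval_nat_numeral gbinomial_Suc)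
  have "0 = nprod \<omega> m (nprod v 0 c) - nprod v 0 (nprod \<omega> m c)"
    by (simp add: v0)
  also have "\<dots> =
    (\<Sum>i<4. scale (of_int m gchoose i) (nprod (nprod \<omega> (int i) v) (m + 0 - int i) c))"
    by (rule commutator_truncated) (rule nprod_eq_0[OF omega_grading v], simp)
  also have "{..<4::nat} = {0,1,2,3}" by auto
  also have "(\<Sum>i\<in>{0,1,2,3::nat}. scale (of_int m gchoose i) (nprod (nprod \<omega> (int i) v) (m + 0 - int i) c))
      = nprod (translation v) m c + scale (of_int m) (nprod (scale 2 v) (m - 1) c)
      + scale (of_int m gchoose 2) (nprod (nprod \<omega> 2 v) (m - 2) c)"
    using L0_grading[OF v] vac by (simp add: omega_0 k)
  also have "nprod (translation v) m c + scale (of_int m) (nprod (scale 2 v) (m - 1) c) =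
    scale (of_int m) (nprod v (m - 1) c)"
    by (simp add: nprod_translation nprod_scale_left flip: scale_left_diff_distrib)
  finally show ?thesis
    by (simp add: eq_neg_iff_add_eq_0)
qed

text \<open>For \<open>w\<close> in the radical of the pairing \<open>u(1)v\<close> on \<open>V 1\<close>, all products of \<open>w\<close> that land in
  degree 0 vanish: \<open>L(1)\<close> kills \<open>V 1\<close>, so \<open>[L(1), w(n)] = -n w(n+1)\<close> carries the vanishing
  from \<open>V n\<close> to \<open>V (n+1)\<close>.\<close>

lemma nprod_top_degree:
  assumes w: "w \<in> V 1" and w1: "\<And>u. u \<in> V 1 \<Longrightarrow> nprod w 1 u = 0"
  shows "x \<in> V (int n) \<Longrightarrow> nprod w (int n) x = 0"
proof (induction n arbitrary: x)
  case 0
  then have "x \<in> span {vac}" using V0 by simp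
  then obtain r where "x = scale r vac"
    by (auto simp: span_singleton)
  then show ?case by (simp add: nprod_scale_right vac_right)
next
  case (Suc n)
  show ?case
  proof (cases "n = 0")
    case True
    then show ?thesis using w1 Suc.prems by simp
  next
    case False
    have "nprod \<omega> 2 x \<in> V (int n)"
      using nprod_grading[OF omega_grading Suc.prems, of 2] by simp
    then have "nprod w (int n) (nprod \<omega> 2 x) = 0" by (rule Suc.IH)
    moreover have "nprod w (int n) x \<in> V 1"
      using nprod_grading[OF w Suc.prems, of "int n"] by simp
    then have "nprod \<omega> 2 (nprod w (int n) x) = 0" using L1_V1 by simp
    ultimately have "scale (of_int (- int n)) (nprod w (int n + 1) x) = 0"
      using L1_commutator[OF w, of "int n" x] by simp
    then show ?thesis using False by (simp add: add.commute)
  qed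
qed

end

text \<open>The pairing \<open>u(1)v\<close> on \<open>V 1\<close> has trivial radical: an element \<open>w\<close> of the radical
  generates the ideal spanned by the \<open>x(k)w\<close>, whose degree-0 part vanishes.\<close>

lemma (in simple_strong_cft_type_voa) nondegenerate_V1:
  assumes w: "w \<in> V 1" and w1: "\<And>u. u \<in> V 1 \<Longrightarrow> nprod w 1 u = 0"
  shows "w = 0"
proof (rule ccontr)
  assume "w \<noteq> 0"
  let ?S = "span {nprod x k w | x k. True}"
  have homogeneous: "component (nprod x k w) 0 = 0" if x: "x \<in> V m" for x k m
  proof (cases "m = k")
    case False
    have "nprod x k w \<in> V (m - k)"
      using nprod_grading[OF x w, of k] by simp
    then show ?thesis using False component_homogeneous by auto
  next
    case True
    have "scale (- ((- 1) powi k)) (nprod w k x) = nprod x k w"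
      unfolding skew_symmetry[symmetric]
      by (subst Sum_any_eq_single[of 0])
        (auto simp: creation nprod_eq_0[OF x w] True)
    moreover have "nprod w k x = 0"
    proof (cases "k < 0")
      case True
      then have "x = 0" using x \<open>m = k\<close> nonneg_grading by auto
      then show ?thesis by simp
    next
      case False
      then show ?thesis
        using nprod_top_degree[OF w w1, of x "nat k"] x \<open>m = k\<close> by simp
    qed
    ultimately have "nprod x k w = 0" by simp
    then show ?thesis by simp
  qed
  have "component (nprod x k w) 0 = 0" for x k
  proof -
    have "nprod x k w = (\<Sum>n\<in>{n. component x n \<noteq> 0}. nprod (component x n) k w)"
      by (subst sum_component[of x]) (rule nprod_sum_left)
    also have "\<dots> \<in> {v. component v 0 = 0}"
      using homogeneous[OF component(1)] by (intro subspace_sum subspace_component_0) auto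
    finally show ?thesis by simp
  qed
  then have "?S \<subseteq> {v. component v 0 = 0}"
    by (intro span_minimal subspace_component_0) auto
  moreover have "nprod vac (- 1) w \<in> ?S"
    by (rule span_base) blast
  then have "w \<in> ?S" by (simp add: vac_left)
  with \<open>w \<noteq> 0\<close> have "?S = UNIV"
    using simple ideal_generated[of w] unfolding is_simple_def by blast
  ultimately have "component vac 0 = 0" by blast
  then have "vac = 0" using component_homogeneous[OF vac_grading] by simp
  then have "w = 0" using vac_left[of "- 1" w] by simp
  with \<open>w \<noteq> 0\<close> show False by simp
qed

section \<open>Comparison of two conformal vectors\<close>

context simple_strong_cft_type_voa
begin

text \<open>The eigenvalues of \<open>a(1)\<close> on \<open>V 1\<close> are at least 1, and an eigenvector of eigenvalue
  \<open>n > 1\<close> lies in the radical of the pairing on \<open>V 1\<close>, since the two degree-0 spaces agree.\<close>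

lemma V1_subset:
  assumes A: "strong_cft_type_voa scale nprod vac V' a" and a: "a \<in> V 2"
    and u: "u \<in> V 1"
  shows "u \<in> V' 1"
proof -
  interpret A: strong_cft_type_voa scale nprod vac V' a by fact
  have V'0: "V' 0 = V 0" using V0 A.V0 by simp
  have comp: "A.component y n \<in> V 1" if y: "y \<in> V 1" for y n
  proof -
    have "nprod \<omega> 1 (A.component y n) = A.component (nprod \<omega> 1 y) n"
      by (rule A.component_commute[OF module_hom_right, symmetric])
        (simp add: A.mem_V_iff nprod_scale_right flip: omega_1_commutes[OF a])
    also have "\<dots> = scale (of_int 1) (A.component y n)"
      using y by (simp add: mem_V_iff)
    finally show ?thesis by (simp only: mem_V_iff)
  qed
  have small: "A.component y n = 0" if y: "y \<in> V 1" and n: "n < 1" for y n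
  proof (cases "n = 0")
    case True
    then have "A.component y n \<in> V 0" using A.component(1)[of y n] V'0 by simp
    with comp[OF y, of n] show ?thesis by (simp add: mem_V_iff)
  next
    case False
    then show ?thesis using n A.component(1)[of y n] A.nonneg_grading[of n] by auto
  qed
  have large: "A.component u n = 0" if n: "n > 1" for n
  proof (rule nondegenerate_V1[OF comp[OF u]])
    fix y assume y: "y \<in> V 1"
    have "nprod (A.component u n) 1 (A.component y m) = 0" (is "?z = 0") for m
    proof (cases "m < 1")
      case True
      then show ?thesis by (simp add: small[OF y])
    next
      case False
      have "?z \<in> V 0"
        using nprod_grading[OF comp[OF u] comp[OF y], where k = 1] by simp
      then have "nprod a 1 ?z = 0" using V'0 A.mem_V_iff[of ?z 0] by simp
      moreover have "?z \<in> V' (n + m - 2)"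
        using A.nprod_grading[OF A.component(1) A.component(1), where k = 1]
        by (simp only: diff_diff_eq one_add_one)
      ultimately have "scale (of_int (n + m - 2)) ?z = 0" by (simp only: A.mem_V_iff)
      moreover have "(of_int (n + m - 2) :: 'k) \<noteq> 0"
        using n False by (simp only: of_int_eq_0_iff)
      ultimately show ?thesis by simp
    qed
    then show "nprod (A.component u n) 1 y = 0"
      by (subst A.sum_component[of y]) (simp only: nprod_sum_right sum.neutral_const)
  qed
  have "A.component u n = 0" if "n \<noteq> 1" for n
    using small[OF u, of n] large[of n] that by linarith
  then have "u = A.component u 1"
    using A.component(3)[of u] Sum_any_eq_single[of 1 "A.component u"] by metis
  then show ?thesis using A.component(1)[of u 1] by simp
qed

theorem conformal_vector_unique:
  assumes A: "strong_cft_type_voa scale nprod vac V' a" and a: "a \<in> V 2"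
  shows "a = \<omega>"
proof -
  interpret A: strong_cft_type_voa scale nprod vac V' a by fact
  define v where "v = \<omega> - a"
  \<comment> \<open>Here \<open>w\<close> is \<open>L(1)v\<close>, without the factor \<open>1/2\<close>.\<close>
  define w where "w = nprod \<omega> 2 v"
  have v: "v \<in> V 2"
    unfolding v_def using omega_grading a by (simp add: subspace_V subspace_diff)
  have v0: "nprod v 0 c = 0" for c
    by (simp add: v_def nprod_diff_left omega_0 A.omega_0)
  have w: "w \<in> V 1"
    unfolding w_def using nprod_grading[OF omega_grading v, of 2] by simp
  have "w = 0"
  proof (rule nondegenerate_V1[OF w])
    fix u assume u: "u \<in> V 1"
    have "nprod a 2 u = 0" using A.L1_V1[OF V1_subset[OF A a u]] by simp
    moreover have "nprod \<omega> 2 u = 0" using L1_V1[OF u] by simp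
    ultimately have "nprod v 2 u = 0" by (simp add: v_def nprod_diff_left)
    then show "nprod w 1 u = 0"
      using modes_if_zero_mode_eq_0[OF v v0, of 3 u]
      by (simp add: w_def eval_nat_numeral gbinomial_Suc)
  qed
  then have "nprod v (- 2) vac = 0"
    using modes_if_zero_mode_eq_0[OF v v0, of "- 1" vac] by (simp add: w_def)
  then have T: "nprod \<omega> 0 v = 0" by (simp add: omega_0 translation_def)
  obtain c where "\<forall>n m v. nprod \<omega> (n + 1) (nprod \<omega> (m + 1) v) - nprod \<omega> (m + 1) (nprod \<omega> (n + 1) v) =
         scale (of_int (n - m)) (nprod \<omega> (n + m + 1) v) +
         scale (1 / 12 * (if n + m = 0 then 1 else 0) * of_int (n ^ 3 - n) * c) v"
    using virasoro by blast
  \<comment> \<open>The central term vanishes, as \<open>n ^ 3 - n = 0\<close> for \<open>n = 1\<close>.\<close>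
  from this[rule_format, of 1 "- 1" v] have "scale 2 (nprod \<omega> 1 v) = 0"
    using T \<open>w = 0\<close> by (simp add: w_def)
  then have "v = 0" using v by (simp add: mem_V_iff)
  then show ?thesis by (simp add: v_def)
qed

lemma CV_sCFT_Int_V2: "CV_sCFT scale nprod vac \<inter> V 2 = {\<omega>}"
proof -
  have "(\<lambda>n. {v. nprod \<omega> 1 v = scale (of_int n) v}) = V"
    by (auto simp: mem_V_iff)
  then have "\<omega> \<in> CV_sCFT scale nprod vac"
    using strong_cft_type_voa_axioms by (simp add: CV_sCFT_def)
  moreover have "a = \<omega>" if "a \<in> CV_sCFT scale nprod vac" "a \<in> V 2" for a
    using that conformal_vector_unique unfolding CV_sCFT_def by blast
  ultimately show ?thesis
    using omega_grading by blast
qed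

end

theorem lemma5p2:
  "(\<forall>(scale :: real \<Rightarrow> 'v::ab_group_add \<Rightarrow> 'v) nprod vac V \<omega>.
      simple_strong_cft_type_voa scale nprod vac V \<omega> \<longrightarrow>
      CV_sCFT scale nprod vac \<inter> V 2 = {\<omega>}) \<and>
   (\<forall>(scale :: complex \<Rightarrow> 'v \<Rightarrow> 'v) nprod vac V \<omega>.
      simple_strong_cft_type_voa scale nprod vac V \<omega> \<longrightarrow>
      CV_sCFT scale nprod vac \<inter> V 2 = {\<omega>})"
  by (intro conjI allI impI simple_strong_cft_type_voa.CV_sCFT_Int_V2)

end
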